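(* Let $\alpha<\beta$ be real numbers. Let $u(t)$, $b(t)$, $k(t,s)$, $h(t,s,\sigma)$ be nonnegative continuous functions for $\alpha\le\sigma\le s\le t\le\beta$ and suppose that $$u(t)\le a(t)+\int_\alpha^t b(s)u^p(s)\,ds+\int_\alpha^t\int_\alpha^s k(s,\tau)u^p(\tau)\,d\tau\,ds+\int_\alpha^t\int_\alpha^s\int_\alpha^\tau h(s,\tau,\sigma)u^p(\sigma)\,d\sigma\,d\tau\,ds$$ for any $t\in[\alpha,\beta]$, where $a(t)$ is a positive nondecreasing function on $[\alpha,\beta]$ and $p\ge 0$ ($p\ne 1$) is a constant. Then $$u(t)\le\left[A^q(t)+q\int_\alpha^t\left(b(s)+\int_\alpha^s k(s,\tau)\,d\tau+\int_\alpha^s\int_\alpha^\tau h(s,\tau,\sigma)\,d\sigma\,d\tau\right)ds\right]^{1/q}$$ for any $t\in[\alpha,\beta_1)$, where $q=1-p$, $A(t)=\sup_{s\in[\alpha,t]}a(s)$, and $\beta_1\in(\alpha,\beta]$ is chosen so that the expression between $[\cdots]$ is positive in the subinterval $[\alpha,\beta_1)$.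
   Context: All functions are real-valued. The functions $u,b$ are defined on $[\alpha,\beta]$, $k$ on $\{(t,s):\alpha\le s\le t\le\beta\}$, and $h$ on $\{(t,s,\sigma):\alpha\le\sigma\le s\le t\le\beta\}$. The notation $u^p(s)$ means $(u(s))^p$, and $A^q(t)$ means $(A(t))^q$. *)

theory Defs
  imports "HOL-Analysis.Analysis"
begin

(* Real power of a nonnegative base with exponent p >= 0. It differs from powr
   only in that 0 powr 0 = 0 in the library, whereas the usual convention,
   needed for the integrands u(s)^p when p = 0 and u vanishes somewhere, is
   x^0 = 1 for every x >= 0. *)
definition rpow :: "real \<Rightarrow> real \<Rightarrow> real" where
  "rpow x p = (if p = 0 then 1 else x powr p)"

end

theory Submission imports Defs
begin

text \<open>
  The proof follows Bihari's: turn the integral inequality into a differential inequality for its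
  right-hand side and separate variables. Fix \<open>T\<close> and write \<open>L w\<close> for the operator
  \<open>s \<mapsto> b w + \<integral> k w + \<integral>\<integral> h w\<close>. Since \<open>a\<close> is nondecreasing, \<open>A = a\<close>, and the free term may be
  frozen at its largest value \<open>c = a T\<close> on \<open>[\<alpha>, T]\<close>. Then \<open>v(s) = c + \<integral> L (u\<^sup>p)\<close> dominates \<open>u\<close> on
  \<open>[\<alpha>, T]\<close>, is positive and nondecreasing, and has \<open>v' = L (u\<^sup>p)\<close> even where \<open>a\<close> jumps.

  At time \<open>s\<close> the operator \<open>L\<close> only sees values on \<open>[\<alpha>, s]\<close>, and there
  \<open>u\<^sup>p \<le> v\<^sup>p \<le> v(s)\<^sup>p\<close>. The kernels being nonnegative, \<open>L\<close> is monotone and the constant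
  \<open>v(s)\<^sup>p\<close> can be pulled out (\<open>kernel_op_mono\<close>, \<open>kernel_op_const\<close>). So the single, double and
  triple integral together give one inequality \<open>v' \<le> v\<^sup>p L 1\<close>, where \<open>\<integral> L 1\<close> is exactly the
  integral in the bracket of the bound. Dividing by \<open>v\<^sup>p\<close> and integrating yields
  \<open>(v(T)\<^sup>q - c\<^sup>q) / q \<le> \<integral> L 1\<close>, which is the claim at \<open>T\<close> (\<open>bihari_powr\<close>).

  To differentiate \<open>v\<close> one needs \<open>L w\<close> to be continuous for continuous \<open>w\<close>. This rests on
  \<open>continuous_on_integral_upto\<close>, used once for the double integral and twice for the triple one.
\<close>

section \<open>Integrals with a parameter and a moving endpoint\<close>

lemma affine_between:
  fixes \<alpha> m r :: real
  assumes "\<alpha> \<le> m" "0 \<le> r" "r \<le> 1"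
  shows "\<alpha> \<le> \<alpha> + r * (m - \<alpha>)" "\<alpha> + r * (m - \<alpha>) \<le> m"
  using mult_right_mono[of r 1 "m - \<alpha>"] assms by auto

lemma integral_rescale_unit_interval:
  fixes f :: "real \<Rightarrow> real"
  assumes "\<alpha> \<le> m" and "continuous_on {\<alpha>..m} f"
  shows "integral {\<alpha>..m} f = (m - \<alpha>) * integral {0..1} (\<lambda>r. f (\<alpha> + r * (m - \<alpha>)))"
proof -
  have "(\<lambda>r. \<alpha> + r * (m - \<alpha>)) ` {0..1} \<subseteq> {\<alpha>..m}"
    using assms(1) affine_between[of \<alpha> m] by auto
  then have "((\<lambda>r. (m - \<alpha>) *\<^sub>R f (\<alpha> + r * (m - \<alpha>))) has_integral
          integral {\<alpha> + 0 * (m - \<alpha>)..\<alpha> + 1 * (m - \<alpha>)} f) {0..1}"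
    using assms
    by (intro has_integral_substitution[where c = \<alpha> and d = m])
      (auto intro!: derivative_eq_intros)
  from integral_unique[OF this] show ?thesis by simp
qed

lemma continuous_on_Sigma_slice:
  assumes "continuous_on (Sigma U B) (\<lambda>(x, t). f x t)" and "x \<in> U"
  shows "continuous_on (B x) (f x)"
proof -
  have "continuous_on (B x) (\<lambda>t. (\<lambda>(x, t). f x t) (x, t))"
    by (rule continuous_on_compose2[OF assms(1)]) (use assms(2) in \<open>auto intro!: continuous_intros\<close>)
  then show ?thesis by simp
qed

text \<open>
  The substitution \<open>t = \<alpha> + r (m x - \<alpha>)\<close> moves the endpoint into the integrand, where the
  theorem on integrals over a fixed interval applies. All values of \<open>f\<close> that occur lie below the
  graph of \<open>m\<close>, so \<open>f\<close> does not have to be extended beyond that region; this is what makes the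
  lemma fit kernels given only on a triangle.
\<close>

lemma continuous_on_integral_upto:
  fixes f :: "'a::topological_space \<Rightarrow> real \<Rightarrow> real"
  assumes m: "continuous_on U m" "\<And>x. x \<in> U \<Longrightarrow> \<alpha> \<le> m x"
    and f: "continuous_on (SIGMA x:U. {\<alpha>..m x}) (\<lambda>(x, t). f x t)"
  shows "continuous_on U (\<lambda>x. integral {\<alpha>..m x} (f x))"
proof -
  have slice: "continuous_on {\<alpha>..m x} (f x)" if "x \<in> U" for x
    using continuous_on_Sigma_slice[OF f that] .
  have "continuous_on (U \<times> {0..1}) (\<lambda>y. (\<lambda>(x, t). f x t) (fst y, \<alpha> + snd y * (m (fst y) - \<alpha>)))"
  proof (rule continuous_on_compose2[OF f])
    show "continuous_on (U \<times> {0..1}) (\<lambda>y. (fst y, \<alpha> + snd y * (m (fst y) - \<alpha>)))"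
      by (auto intro!: continuous_intros continuous_on_compose2[OF m(1)])
  qed (use m(2) affine_between in auto)
  then have "continuous_on (U \<times> cbox 0 (1::real)) (\<lambda>(x, r). f x (\<alpha> + r * (m x - \<alpha>)))"
    by (simp add: case_prod_unfold)
  from integral_continuous_on_param[OF this]
  have "continuous_on U (\<lambda>x. (m x - \<alpha>) * integral {0..1} (\<lambda>r. f x (\<alpha> + r * (m x - \<alpha>))))"
    by (auto intro!: continuous_intros m)
  then show ?thesis
    by (subst continuous_on_cong[OF refl])
      (auto intro!: integral_rescale_unit_interval slice m)
qed

section \<open>The iterated integral operator\<close>

locale iterated_kernels =
  fixes \<alpha> \<beta> :: real
    and b :: "real \<Rightarrow> real"
    and k :: "real \<Rightarrow> real \<Rightarrow> real"
    and h :: "real \<Rightarrow> real \<Rightarrow> real \<Rightarrow> real"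
  assumes cont_b: "continuous_on {\<alpha>..\<beta>} b"
    and cont_k: "continuous_on {(t, s). \<alpha> \<le> s \<and> s \<le> t \<and> t \<le> \<beta>} (\<lambda>(t, s). k t s)"
    and cont_h: "continuous_on {(t, s, \<sigma>). \<alpha> \<le> \<sigma> \<and> \<sigma> \<le> s \<and> s \<le> t \<and> t \<le> \<beta>}
                   (\<lambda>(t, s, \<sigma>). h t s \<sigma>)"
    and b_nonneg: "\<And>t. \<alpha> \<le> t \<Longrightarrow> t \<le> \<beta> \<Longrightarrow> 0 \<le> b t"
    and k_nonneg: "\<And>t s. \<alpha> \<le> s \<Longrightarrow> s \<le> t \<Longrightarrow> t \<le> \<beta> \<Longrightarrow> 0 \<le> k t s"
    and h_nonneg: "\<And>t s \<sigma>. \<alpha> \<le> \<sigma> \<Longrightarrow> \<sigma> \<le> s \<Longrightarrow> s \<le> t \<Longrightarrow> t \<le> \<beta> \<Longrightarrow> 0 \<le> h t s \<sigma>"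
begin

definition k_term :: "(real \<Rightarrow> real) \<Rightarrow> real \<Rightarrow> real" where
  "k_term w s = integral {\<alpha>..s} (\<lambda>\<tau>. k s \<tau> * w \<tau>)"

definition h_inner :: "(real \<Rightarrow> real) \<Rightarrow> real \<Rightarrow> real \<Rightarrow> real" where
  "h_inner w s \<tau> = integral {\<alpha>..\<tau>} (\<lambda>\<sigma>. h s \<tau> \<sigma> * w \<sigma>)"

definition h_term :: "(real \<Rightarrow> real) \<Rightarrow> real \<Rightarrow> real" where
  "h_term w s = integral {\<alpha>..s} (h_inner w s)"

definition kernel_op :: "(real \<Rightarrow> real) \<Rightarrow> real \<Rightarrow> real" where
  "kernel_op w s = b s * w s + k_term w s + h_term w s"

lemma continuous_k_integrand:
  assumes "continuous_on {\<alpha>..\<beta>} w"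
  shows "continuous_on (SIGMA s:{\<alpha>..\<beta>}. {\<alpha>..s}) (\<lambda>(s, \<tau>). k s \<tau> * w \<tau>)"
proof -
  have "continuous_on (SIGMA s:{\<alpha>..\<beta>}. {\<alpha>..s}) (\<lambda>(s, \<tau>). k s \<tau>)"
    by (rule continuous_on_subset[OF cont_k]) auto
  moreover have "continuous_on (SIGMA s:{\<alpha>..\<beta>}. {\<alpha>..s}) (\<lambda>x. w (snd x))"
    by (rule continuous_on_compose2[OF assms]) (auto intro!: continuous_intros)
  ultimately show ?thesis
    by (auto simp: case_prod_unfold intro!: continuous_intros)
qed

lemma continuous_h_integrand:
  assumes "continuous_on {\<alpha>..\<beta>} w"
  shows "continuous_on (SIGMA x:(SIGMA s:{\<alpha>..\<beta>}. {\<alpha>..s}). {\<alpha>..snd x})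
           (\<lambda>(x, \<sigma>). h (fst x) (snd x) \<sigma> * w \<sigma>)"
    (is "continuous_on ?D _")
proof -
  have "continuous_on ?D (\<lambda>x. (\<lambda>(t, s, \<sigma>). h t s \<sigma>) (fst (fst x), snd (fst x), snd x))"
    by (rule continuous_on_compose2[OF cont_h]) (auto intro!: continuous_intros)
  moreover have "continuous_on ?D (\<lambda>x. w (snd x))"
    by (rule continuous_on_compose2[OF assms]) (auto intro!: continuous_intros)
  ultimately show ?thesis
    by (auto simp: case_prod_unfold intro!: continuous_intros)
qed

lemma continuous_k_term: "continuous_on {\<alpha>..\<beta>} w \<Longrightarrow> continuous_on {\<alpha>..\<beta>} (k_term w)"
  unfolding k_term_def
  by (rule continuous_on_integral_upto) (auto intro: continuous_k_integrand)

lemma continuous_h_inner: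
  assumes "continuous_on {\<alpha>..\<beta>} w"
  shows "continuous_on (SIGMA s:{\<alpha>..\<beta>}. {\<alpha>..s}) (\<lambda>(s, \<tau>). h_inner w s \<tau>)"
  unfolding h_inner_def case_prod_unfold
  by (rule continuous_on_integral_upto)
    (use continuous_h_integrand[OF assms] in \<open>auto intro!: continuous_intros\<close>)

lemma continuous_h_term: "continuous_on {\<alpha>..\<beta>} w \<Longrightarrow> continuous_on {\<alpha>..\<beta>} (h_term w)"
  unfolding h_term_def
  by (rule continuous_on_integral_upto) (auto intro: continuous_h_inner)

lemma continuous_kernel_op:
  "continuous_on {\<alpha>..\<beta>} w \<Longrightarrow> continuous_on {\<alpha>..\<beta>} (kernel_op w)"
  unfolding kernel_op_def
  by (intro continuous_intros cont_b continuous_k_term continuous_h_term)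

lemma k_integrand_integrable:
  assumes "continuous_on {\<alpha>..\<beta>} w" "s \<in> {\<alpha>..\<beta>}"
  shows "(\<lambda>\<tau>. k s \<tau> * w \<tau>) integrable_on {\<alpha>..s}"
  using continuous_on_Sigma_slice[OF continuous_k_integrand[OF assms(1)] assms(2)]
  by (rule integrable_continuous_real)

lemma h_inner_integrable:
  assumes "continuous_on {\<alpha>..\<beta>} w" "s \<in> {\<alpha>..\<beta>}"
  shows "h_inner w s integrable_on {\<alpha>..s}"
  using continuous_on_Sigma_slice[OF continuous_h_inner[OF assms(1)] assms(2)]
  by (rule integrable_continuous_real)

lemma h_integrand_integrable:
  assumes "continuous_on {\<alpha>..\<beta>} w" "s \<in> {\<alpha>..\<beta>}" "\<tau> \<in> {\<alpha>..s}"
  shows "(\<lambda>\<sigma>. h s \<tau> \<sigma> * w \<sigma>) integrable_on {\<alpha>..\<tau>}"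
  using continuous_on_Sigma_slice[OF continuous_h_integrand[OF assms(1)], of "(s, \<tau>)"] assms(2,3)
  by (simp add: integrable_continuous_real)

text \<open>
  The comparison is only required on \<open>[\<alpha>, s]\<close>: the operator is causal. This is what allows a
  nondecreasing bound on \<open>w\<close> to be replaced by its value at \<open>s\<close>.
\<close>

lemma kernel_op_mono:
  assumes w: "continuous_on {\<alpha>..\<beta>} w" "continuous_on {\<alpha>..\<beta>} w'" and s: "s \<in> {\<alpha>..\<beta>}"
    and le: "\<And>\<tau>. \<tau> \<in> {\<alpha>..s} \<Longrightarrow> w \<tau> \<le> w' \<tau>"
  shows "kernel_op w s \<le> kernel_op w' s"
proof -
  have "b s * w s \<le> b s * w' s"
    using s le b_nonneg by (auto intro!: mult_left_mono)
  moreover have "k_term w s \<le> k_term w' s"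
    unfolding k_term_def
    by (rule integral_le) (use s in \<open>auto intro!: k_integrand_integrable w mult_left_mono le k_nonneg\<close>)
  moreover have "h_inner w s \<tau> \<le> h_inner w' s \<tau>" if "\<tau> \<in> {\<alpha>..s}" for \<tau>
    unfolding h_inner_def
    by (rule integral_le)
      (use s that in \<open>auto intro!: h_integrand_integrable w mult_left_mono le h_nonneg\<close>)
  then have "h_term w s \<le> h_term w' s"
    unfolding h_term_def by (intro integral_le h_inner_integrable w s) auto
  ultimately show ?thesis unfolding kernel_op_def by linarith
qed

lemma kernel_op_const: "kernel_op (\<lambda>_. c) s = c * kernel_op (\<lambda>_. 1) s"
  by (simp add: kernel_op_def k_term_def h_term_def h_inner_def[abs_def] algebra_simps)

lemma kernel_op_nonneg:
  assumes "continuous_on {\<alpha>..\<beta>} w" "s \<in> {\<alpha>..\<beta>}" "\<And>\<tau>. \<tau> \<in> {\<alpha>..s} \<Longrightarrow> 0 \<le> w \<tau>"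
  shows "0 \<le> kernel_op w s"
  using kernel_op_mono[of "\<lambda>_. 0" w s] kernel_op_const[of 0 s] assms by simp

lemma integral_kernel_op:
  assumes "continuous_on {\<alpha>..\<beta>} w" "t \<in> {\<alpha>..\<beta>}"
  shows "integral {\<alpha>..t} (kernel_op w) =
    integral {\<alpha>..t} (\<lambda>s. b s * w s) + integral {\<alpha>..t} (k_term w) + integral {\<alpha>..t} (h_term w)"
proof -
  have sub: "{\<alpha>..t} \<subseteq> {\<alpha>..\<beta>}" using assms by auto
  have "(\<lambda>s. b s * w s) integrable_on {\<alpha>..t}" "k_term w integrable_on {\<alpha>..t}"
    "h_term w integrable_on {\<alpha>..t}"
    by (intro integrable_continuous_real continuous_on_subset[OF _ sub] continuous_intros cont_b
        continuous_k_term continuous_h_term assms)+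
  then show ?thesis
    unfolding kernel_op_def by (simp add: integral_add integrable_add)
qed

end

section \<open>The differential inequality\<close>

text \<open>
  In the variable \<open>v\<^sup>q / q\<close> the inequality \<open>v' \<le> v\<^sup>1\<^sup>-\<^sup>q K\<close> says that the derivative is at most
  \<open>K\<close>, whatever the sign of \<open>q\<close>. For \<open>q < 0\<close> solving for \<open>v\<close> reverses the order twice, once on
  multiplying by \<open>q\<close> and once on taking the decreasing power \<open>1 / q\<close>; the second reversal is
  where positivity of the bracket enters, as the bound blows up when the bracket reaches zero.
\<close>

lemma bihari_powr:
  fixes G K :: "real \<Rightarrow> real" and \<alpha> T c q :: real
  defines "v \<equiv> \<lambda>s. c + integral {\<alpha>..s} G"
  assumes "\<alpha> \<le> T" and "0 < c" and "q \<noteq> 0"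
    and G: "continuous_on {\<alpha>..T} G" "\<And>s. s \<in> {\<alpha>..T} \<Longrightarrow> 0 \<le> G s"
    and K: "continuous_on {\<alpha>..T} K"
    and le: "\<And>s. s \<in> {\<alpha>..T} \<Longrightarrow> G s \<le> v s powr (1 - q) * K s"
    and pos: "0 < c powr q + q * integral {\<alpha>..T} K"
  shows "v T \<le> (c powr q + q * integral {\<alpha>..T} K) powr (1 / q)"
    (is "_ \<le> ?B powr _")
proof -
  have v_pos: "0 < v s" if "s \<in> {\<alpha>..T}" for s
  proof -
    have "0 \<le> integral {\<alpha>..s} G"
      by (rule integral_nonneg)
        (use that G in \<open>auto intro!: integrable_continuous_real intro: continuous_on_subset\<close>)
    with \<open>0 < c\<close> show ?thesis by (simp add: v_def)
  qed
  have deriv: "((\<lambda>s. v s powr q / q) has_real_derivative v s powr (q - 1) * G s)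
      (at s within {\<alpha>..T})" if "s \<in> {\<alpha>..T}" for s
  proof -
    have "(v has_real_derivative G s) (at s within {\<alpha>..T})"
      unfolding v_def
      by (auto intro!: derivative_eq_intros integral_has_real_derivative[OF G(1) that])
    from DERIV_cdivide[OF DERIV_chain2[OF has_real_derivative_powr[OF v_pos[OF that]] this], of q q]
    show ?thesis using \<open>q \<noteq> 0\<close> by simp
  qed
  have "((\<lambda>s. v s powr (q - 1) * G s) has_integral v T powr q / q - v \<alpha> powr q / q) {\<alpha>..T}"
    by (rule fundamental_theorem_of_calculus)
      (use \<open>\<alpha> \<le> T\<close> deriv in \<open>auto simp: has_real_derivative_iff_has_vector_derivative\<close>)
  moreover have "(K has_integral integral {\<alpha>..T} K) {\<alpha>..T}"
    by (intro integrable_integral integrable_continuous_real K)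
  moreover have "v s powr (q - 1) * G s \<le> K s" if "s \<in> {\<alpha>..T}" for s
  proof -
    have "v s powr (q - 1) * G s \<le> v s powr (q - 1) * (v s powr (1 - q) * K s)"
      by (intro mult_left_mono le that) simp
    also have "\<dots> = v s powr (q - 1 + (1 - q)) * K s"
      by (simp only: powr_add mult.assoc)
    also have "\<dots> = K s" using v_pos[OF that] by simp
    finally show ?thesis .
  qed
  ultimately have "v T powr q / q - v \<alpha> powr q / q \<le> integral {\<alpha>..T} K"
    by (rule has_integral_le)
  then have main: "v T powr q / q - c powr q / q \<le> integral {\<alpha>..T} K"
    by (simp add: v_def)
  have vT: "0 < v T" using v_pos \<open>\<alpha> \<le> T\<close> by simp
  have root: "(v T powr q) powr (1 / q) = v T"
    using vT \<open>q \<noteq> 0\<close> by (simp add: powr_powr)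
  show ?thesis
  proof (cases "0 < q")
    case True
    then have "v T powr q \<le> ?B" using main by (simp add: field_simps)
    then have "(v T powr q) powr (1 / q) \<le> ?B powr (1 / q)"
      using True by (intro powr_mono2) auto
    then show ?thesis by (simp add: root)
  next
    case False
    with \<open>q \<noteq> 0\<close> have "q < 0" by simp
    then have "?B \<le> v T powr q" using main by (simp add: field_simps)
    then have "(v T powr q) powr (1 / q) \<le> ?B powr (1 / q)"
      using \<open>q < 0\<close> pos by (intro powr_mono2') auto
    then show ?thesis by (simp add: root)
  qed
qed

section \<open>The inequality\<close>

lemma rpow_mono:
  assumes "0 \<le> p" "0 \<le> x" "x \<le> y"
  shows "rpow x p \<le> rpow y p"
  using assms by (auto simp: rpow_def intro: powr_mono2)

lemma continuous_on_rpow: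
  assumes "continuous_on S f" "0 \<le> p" "\<And>x. x \<in> S \<Longrightarrow> 0 \<le> f x"
  shows "continuous_on S (\<lambda>x. rpow (f x) p)"
  using assms by (cases "p = 0") (auto simp: rpow_def intro!: continuous_on_powr')

theorem theorem3p3:
  fixes \<alpha> \<beta> \<beta>1 p q :: real
    and u a b A E :: "real \<Rightarrow> real"
    and k :: "real \<Rightarrow> real \<Rightarrow> real"
    and h :: "real \<Rightarrow> real \<Rightarrow> real \<Rightarrow> real"
  assumes "\<alpha> < \<beta>"
    and "continuous_on {\<alpha>..\<beta>} u"
    and "continuous_on {\<alpha>..\<beta>} b"
    and "continuous_on {(t, s). \<alpha> \<le> s \<and> s \<le> t \<and> t \<le> \<beta>} (\<lambda>(t, s). k t s)"
    and "continuous_on {(t, s, \<sigma>). \<alpha> \<le> \<sigma> \<and> \<sigma> \<le> s \<and> s \<le> t \<and> t \<le> \<beta>} (\<lambda>(t, s, \<sigma>). h t s \<sigma>)"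
    and "\<And>t. \<alpha> \<le> t \<Longrightarrow> t \<le> \<beta> \<Longrightarrow> 0 \<le> u t"
    and "\<And>t. \<alpha> \<le> t \<Longrightarrow> t \<le> \<beta> \<Longrightarrow> 0 \<le> b t"
    and "\<And>t s. \<alpha> \<le> s \<Longrightarrow> s \<le> t \<Longrightarrow> t \<le> \<beta> \<Longrightarrow> 0 \<le> k t s"
    and "\<And>t s \<sigma>. \<alpha> \<le> \<sigma> \<Longrightarrow> \<sigma> \<le> s \<Longrightarrow> s \<le> t \<Longrightarrow> t \<le> \<beta> \<Longrightarrow> 0 \<le> h t s \<sigma>"
    and "\<And>t. \<alpha> \<le> t \<Longrightarrow> t \<le> \<beta> \<Longrightarrow> 0 < a t"
    and "mono_on {\<alpha>..\<beta>} a"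
    and "0 \<le> p" and "p \<noteq> 1"
    and "\<And>t. \<alpha> \<le> t \<Longrightarrow> t \<le> \<beta> \<Longrightarrow>
           u t \<le> a t
             + integral {\<alpha>..t} (\<lambda>s. b s * rpow (u s) p)
             + integral {\<alpha>..t} (\<lambda>s. integral {\<alpha>..s} (\<lambda>\<tau>. k s \<tau> * rpow (u \<tau>) p))
             + integral {\<alpha>..t} (\<lambda>s. integral {\<alpha>..s} (\<lambda>\<tau>.
                 integral {\<alpha>..\<tau>} (\<lambda>\<sigma>. h s \<tau> \<sigma> * rpow (u \<sigma>) p)))"
    and "q = 1 - p"
    and "\<And>t. \<alpha> \<le> t \<Longrightarrow> t \<le> \<beta> \<Longrightarrow> A t = (SUP s\<in>{\<alpha>..t}. a s)"
    and "\<And>t. \<alpha> \<le> t \<Longrightarrow> t \<le> \<beta> \<Longrightarrow>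
           E t = A t powr q
             + q * integral {\<alpha>..t} (\<lambda>s. b s
                 + integral {\<alpha>..s} (\<lambda>\<tau>. k s \<tau>)
                 + integral {\<alpha>..s} (\<lambda>\<tau>. integral {\<alpha>..\<tau>} (\<lambda>\<sigma>. h s \<tau> \<sigma>)))"
    and "\<alpha> < \<beta>1" and "\<beta>1 \<le> \<beta>"
    and "\<And>t. \<alpha> \<le> t \<Longrightarrow> t < \<beta>1 \<Longrightarrow> 0 < E t"
  shows "\<forall>t\<in>{\<alpha>..<\<beta>1}. u t \<le> E t powr (1 / q)"
proof
  fix T assume T: "T \<in> {\<alpha>..<\<beta>1}"
  interpret iterated_kernels \<alpha> \<beta> b k h
    by unfold_locales (use assms in auto)
  have T\<beta>: "\<alpha> \<le> T" "T \<le> \<beta>" using T \<open>\<beta>1 \<le> \<beta>\<close> by auto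
  have a_le: "a s \<le> a T" if "s \<in> {\<alpha>..T}" for s
    using mono_onD[OF \<open>mono_on {\<alpha>..\<beta>} a\<close>, of s T] that T\<beta> by auto
  have A_T: "A T = a T"
    using T\<beta> assms(16)[of T] a_le by (auto intro!: cSup_eq_maximum)
  define w where "w = (\<lambda>s. rpow (u s) p)"
  \<comment> \<open>The free term is \<open>a T\<close>, not \<open>a s\<close>: only the bound at \<open>T\<close> is wanted, and \<open>v\<close> has to be differentiable.\<close>
  define v where "v = (\<lambda>s. a T + integral {\<alpha>..s} (kernel_op w))"
  have w: "continuous_on {\<alpha>..\<beta>} w"
    unfolding w_def by (rule continuous_on_rpow) (use assms in auto)
  have w_nonneg: "0 \<le> w s" for s by (simp add: w_def rpow_def)
  have op_cont: "continuous_on {\<alpha>..T} (kernel_op w')" if "continuous_on {\<alpha>..\<beta>} w'" for w'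
    by (rule continuous_on_subset[OF continuous_kernel_op[OF that]]) (use T\<beta> in auto)
  have op_nonneg: "0 \<le> kernel_op w s" if "s \<in> {\<alpha>..T}" for s
    by (rule kernel_op_nonneg) (use that T\<beta> w w_nonneg in auto)
  have v_mono: "v s \<le> v t" if "\<alpha> \<le> s" "s \<le> t" "t \<le> T" for s t
    unfolding v_def
    by (intro add_left_mono integral_subset_le integrable_continuous_real
        continuous_on_subset[OF op_cont[OF w]]) (use that op_nonneg in auto)
  have u_le: "u s \<le> v s" if s: "s \<in> {\<alpha>..T}" for s
  proof -
    have "u s \<le> a s + integral {\<alpha>..s} (kernel_op w)"
      using assms(14)[of s] s T\<beta> integral_kernel_op[OF w, of s]
      by (simp add: w_def k_term_def[abs_def] h_term_def[abs_def] h_inner_def[abs_def])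
    with a_le[OF s] show ?thesis by (simp add: v_def)
  qed
  have v_pos: "0 < v s" if "s \<in> {\<alpha>..T}" for s
    using v_mono[of \<alpha> s] assms(10)[of T] that T\<beta> by (simp add: v_def)
  have E_T: "E T = a T powr q + q * integral {\<alpha>..T} (kernel_op (\<lambda>_. 1))"
    using assms(17)[of T] T\<beta>
    by (simp add: A_T kernel_op_def[abs_def] k_term_def h_term_def h_inner_def[abs_def])
  have "v T \<le> (a T powr q + q * integral {\<alpha>..T} (kernel_op (\<lambda>_. 1))) powr (1 / q)"
    unfolding v_def
  proof (rule bihari_powr)
    fix s assume s: "s \<in> {\<alpha>..T}"
    have "kernel_op w s \<le> kernel_op (\<lambda>_. v s powr p) s"
    proof (rule kernel_op_mono)
      fix \<tau> assume \<tau>: "\<tau> \<in> {\<alpha>..s}"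
      with s T\<beta> have "0 \<le> u \<tau>" "u \<tau> \<le> v s"
        using assms(6)[of \<tau>] u_le[of \<tau>] v_mono[of \<tau> s] by auto
      then have "w \<tau> \<le> rpow (v s) p"
        unfolding w_def using \<open>0 \<le> p\<close> by (intro rpow_mono)
      \<comment> \<open>The conventions for \<open>0\<^sup>0\<close> differ, but \<open>v\<close> stays away from \<open>0\<close>.\<close>
      also have "\<dots> = v s powr p" using v_pos[OF s] by (simp add: rpow_def)
      finally show "w \<tau> \<le> v s powr p" .
    qed (use s T\<beta> w in auto)
    also have "\<dots> = v s powr (1 - q) * kernel_op (\<lambda>_. 1) s"
      by (subst kernel_op_const) (simp add: \<open>q = 1 - p\<close>)
    finally show "kernel_op w s \<le>
        (a T + integral {\<alpha>..s} (kernel_op w)) powr (1 - q) * kernel_op (\<lambda>_. 1) s"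
      by (simp add: v_def)
  next
    show "0 < a T powr q + q * integral {\<alpha>..T} (kernel_op (\<lambda>_. 1))"
      using assms(20)[of T] T by (simp add: E_T)
  qed (use T\<beta> assms op_nonneg in \<open>auto intro!: op_cont w\<close>)
  with u_le[of T] T\<beta> show "u T \<le> E T powr (1 / q)" by (simp add: E_T)
qed

end
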